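(* Fix an instance of the (relaxed) Lipschitz MAB problem. Then the regret of the zooming algorithm satisfies, for every time $t$, $$R(t)\le\min_{\rho>0}\Big(\rho t+O(\log^2 t)\sum_{r\in\mathcal{S},\,r\ge\rho}\tfrac1r\,N_{r/8}(X_{\mu,r})\Big),\qquad \mathcal{S}=\{2^{-i}:i\in\mathbb{N}\},$$ where $O(\cdot)$ hides an absolute constant.
   Context: Relaxed setting: a set of arms $X$ with a known function $\mathcal{D}:X\times X\to[0,\infty]$ that is symmetric with $\mathcal{D}(x,x)=0$ (triangle inequality not required); an unknown $\mu:X\to[0,1]$ such that for every $\varepsilon>0$ there is $x^*\in X$ with $\Delta(x)\le\mathcal{D}(x,x^* )+\varepsilon$ for all $x$, where $\mu^*=\sup_x\mu(x)$ and $\Delta(x)=\mu^*-\mu(x)$; for each arm a reward distribution on $[0,1]$ with mean $\mu(x)$, rewards drawn independently each time an arm is played. Regret $R(t)=t\mu^*-\mathbb{E}[\sum_{s\le t}\mu(x_s)]$. $X_{\mu,r}=\{x\in X:r/2<\Delta(x)\le r\}$; $N_r(Y)$ is the minimal number of sets of diameter (w.r.t. $\mathcal{D}$) strictly less than $r$ covering $Y$. $B(x,r)=\{y:\mathcal{D}(x,y)<r\}$. Zooming algorithm: phases $i=1,2,\dots$ of $2^i$ rounds, each starting with no active arms. In phase $i_{ph}$ at time $t$: $n_t(x)$ = number of plays of $x$ in this phase before $t$, $\mu_t(x)$ = their average reward ($0$ if none), $r_t(x)=\sqrt{8i_{ph}/(1+n_t(x))}$. An arm is covered if it lies in $B(y,r_t(y))$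 for some active $y$. Each round: if some arm is uncovered, activate any such arm (active until end of phase); then play an active arm maximizing $\mu_t(x)+2r_t(x)$. *)

theory Defs
  imports "HOL-Probability.Probability"
begin

definition best_mean :: "'a set \<Rightarrow> ('a \<Rightarrow> real) \<Rightarrow> real" where
  "best_mean X \<mu> = (SUP a\<in>X. \<mu> a)"

definition gap :: "'a set \<Rightarrow> ('a \<Rightarrow> real) \<Rightarrow> 'a \<Rightarrow> real" where
  "gap X \<mu> a = best_mean X \<mu> - \<mu> a"

locale relaxed_lipschitz_mab =
  fixes X :: "'a set"
    and D :: "'a \<Rightarrow> 'a \<Rightarrow> ennreal"
    and \<mu> :: "'a \<Rightarrow> real"
    and P :: "'a \<Rightarrow> real measure"
  assumes D_sym: "\<lbrakk>a \<in> X; b \<in> X\<rbrakk> \<Longrightarrow> D a b = D b a"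
    and D_refl: "a \<in> X \<Longrightarrow> D a a = 0"
    and mean_range: "a \<in> X \<Longrightarrow> \<mu> a \<in> {0..1}"
    and relaxed_lipschitz:
      "0 < \<epsilon> \<Longrightarrow> \<exists>x\<^sub>0\<in>X. \<forall>a\<in>X. ennreal (gap X \<mu> a) \<le> D a x\<^sub>0 + ennreal \<epsilon>"
    and reward_prob_space: "a \<in> X \<Longrightarrow> prob_space (P a)"
    and reward_sets: "a \<in> X \<Longrightarrow> sets (P a) = sets borel"
    and reward_range: "a \<in> X \<Longrightarrow> AE v in P a. v \<in> {0..1}"
    and reward_mean: "a \<in> X \<Longrightarrow> (\<integral>v. v \<partial>P a) = \<mu> a"

definition gap_layer :: "'a set \<Rightarrow> ('a \<Rightarrow> real) \<Rightarrow> real \<Rightarrow> 'a set" where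
  "gap_layer X \<mu> r = {a \<in> X. r / 2 < gap X \<mu> a \<and> gap X \<mu> a \<le> r}"

definition set_diam :: "('a \<Rightarrow> 'a \<Rightarrow> ennreal) \<Rightarrow> 'a set \<Rightarrow> ennreal" where
  "set_diam D S = (SUP a\<in>S. SUP b\<in>S. D a b)"

text \<open>The infimum is \<open>\<infinity>\<close> if there is no finite cover.\<close>

definition covering_number ::
  "'a set \<Rightarrow> ('a \<Rightarrow> 'a \<Rightarrow> ennreal) \<Rightarrow> real \<Rightarrow> 'a set \<Rightarrow> enat" where
  "covering_number X D r Y =
     Inf {enat (card \<C>) | \<C>. finite \<C> \<and> (\<forall>S\<in>\<C>. S \<subseteq> X \<and> set_diam D S < ennreal r) \<and> Y \<subseteq> \<Union>\<C>}"

definition dyadic_scales :: "real set" where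
  "dyadic_scales = range (\<lambda>i::nat. 1 / 2 ^ i)"

definition arm_ball ::
  "'a set \<Rightarrow> ('a \<Rightarrow> 'a \<Rightarrow> ennreal) \<Rightarrow> 'a \<Rightarrow> real \<Rightarrow> 'a set" where
  "arm_ball X D a r = {b \<in> X. D a b < ennreal r}"

text \<open>
  Rounds are numbered \<open>1, 2, \<dots>\<close>; index \<open>0\<close> of the sequences below is unused.  The filtration
  \<open>F t\<close> is the information available once the arm of round \<open>t\<close> has been chosen: the rewards of
  the earlier rounds, the arms of the rounds up to \<open>t\<close>, and possibly internal randomness of the
  algorithm.  No \<open>\<sigma>\<close>-algebra on the arms is fixed: all that is required is that the reward
  law of the chosen arm and the events that two rounds play the same arm are \<open>F t\<close>-measurable.
  \<open>reward_law\<close> states that, given that information, the reward is a fresh sample from the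
  reward distribution of the chosen arm.
\<close>

locale bandit_process = prob_space M + filtration "space M" F
  for M :: "'w measure" and F :: "nat \<Rightarrow> 'w measure" +
  fixes X :: "'a set"
    and P :: "'a \<Rightarrow> real measure"
    and x :: "nat \<Rightarrow> 'w \<Rightarrow> 'a"
    and y :: "nat \<Rightarrow> 'w \<Rightarrow> real"
  assumes F_subalgebra: "subalgebra M (F t)"
    and arm_in: "\<lbrakk>1 \<le> t; \<omega> \<in> space M\<rbrakk> \<Longrightarrow> x t \<omega> \<in> X"
    and arm_law_measurable: "1 \<le> t \<Longrightarrow> (\<lambda>\<omega>. P (x t \<omega>)) \<in> F t \<rightarrow>\<^sub>M prob_algebra borel"
    and same_arm_measurable:
      "\<lbrakk>1 \<le> s; s \<le> t\<rbrakk> \<Longrightarrow> {\<omega> \<in> space M. x s \<omega> = x t \<omega>} \<in> sets (F t)"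
    and reward_adapted: "\<lbrakk>1 \<le> s; s < t\<rbrakk> \<Longrightarrow> y s \<in> borel_measurable (F t)"
    and reward_law: "\<lbrakk>1 \<le> t; B \<in> sets borel\<rbrakk> \<Longrightarrow>
      AE \<omega> in M. real_cond_exp M (F t) (\<lambda>\<omega>'. indicator B (y t \<omega>')) \<omega> = measure (P (x t \<omega>)) B"

definition regret ::
  "'a set \<Rightarrow> ('a \<Rightarrow> real) \<Rightarrow> 'w measure \<Rightarrow> (nat \<Rightarrow> 'w \<Rightarrow> 'a) \<Rightarrow> nat \<Rightarrow> real" where
  "regret X \<mu> M x t = real t * best_mean X \<mu> - (\<integral>\<omega>. (\<Sum>s=1..t. \<mu> (x s \<omega>)) \<partial>M)"

text \<open>The phase containing round \<open>t\<close>, when phase \<open>j = 1, 2, \<dots>\<close> has \<open>2 ^ j\<close> rounds.\<close>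

definition phase :: "nat \<Rightarrow> nat" where
  "phase t = (LEAST i. t \<le> (\<Sum>j=1..i. 2 ^ j))"

text \<open>
  In the following, \<open>x\<close>, \<open>y\<close> and \<open>z\<close> are single trajectories: arm played, reward received, and
  arm activated (if any) in each round.
\<close>

definition plays_before :: "(nat \<Rightarrow> 'a) \<Rightarrow> nat \<Rightarrow> 'a \<Rightarrow> nat set" where
  "plays_before x t a = {s. s < t \<and> phase s = phase t \<and> x s = a}"

definition num_plays :: "(nat \<Rightarrow> 'a) \<Rightarrow> nat \<Rightarrow> 'a \<Rightarrow> nat" where
  "num_plays x t a = card (plays_before x t a)"

definition avg_reward :: "(nat \<Rightarrow> 'a) \<Rightarrow> (nat \<Rightarrow> real) \<Rightarrow> nat \<Rightarrow> 'a \<Rightarrow> real" where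
  "avg_reward x y t a =
     (if num_plays x t a = 0 then 0
      else (\<Sum>s\<in>plays_before x t a. y s) / real (num_plays x t a))"

definition conf_radius :: "(nat \<Rightarrow> 'a) \<Rightarrow> nat \<Rightarrow> 'a \<Rightarrow> real" where
  "conf_radius x t a = sqrt (8 * real (phase t) / (1 + real (num_plays x t a)))"

definition arm_index :: "(nat \<Rightarrow> 'a) \<Rightarrow> (nat \<Rightarrow> real) \<Rightarrow> nat \<Rightarrow> 'a \<Rightarrow> real" where
  "arm_index x y t a = avg_reward x y t a + 2 * conf_radius x t a"

definition active_before :: "(nat \<Rightarrow> 'a option) \<Rightarrow> nat \<Rightarrow> 'a set" where
  "active_before z t = {a. \<exists>s<t. phase s = phase t \<and> z s = Some a}"

definition active_at_play :: "(nat \<Rightarrow> 'a option) \<Rightarrow> nat \<Rightarrow> 'a set" where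
  "active_at_play z t = active_before z t \<union> set_option (z t)"

definition uncovered ::
  "'a set \<Rightarrow> ('a \<Rightarrow> 'a \<Rightarrow> ennreal) \<Rightarrow> (nat \<Rightarrow> 'a) \<Rightarrow> (nat \<Rightarrow> 'a option) \<Rightarrow> nat \<Rightarrow> 'a set" where
  "uncovered X D x z t = X - (\<Union>b\<in>active_before z t. arm_ball X D b (conf_radius x t b))"

definition zooming_run ::
  "'a set \<Rightarrow> ('a \<Rightarrow> 'a \<Rightarrow> ennreal) \<Rightarrow> (nat \<Rightarrow> 'a option) \<Rightarrow> (nat \<Rightarrow> 'a) \<Rightarrow> (nat \<Rightarrow> real) \<Rightarrow> bool" where
  "zooming_run X D z x y \<longleftrightarrow> (\<forall>t\<ge>1.
     (if uncovered X D x z t = {} then z t = None else z t \<in> Some ` uncovered X D x z t) \<and>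
     x t \<in> active_at_play z t \<and>
     (\<forall>b\<in>active_at_play z t. arm_index x y t b \<le> arm_index x y t (x t)))"

end

theory Submission
  imports Defs
begin

text \<open>
  Fix a phase \<open>i\<close>. For each round \<open>s\<close>, the centred rewards of the later plays of the arm of round \<open>s\<close>
  are martingale differences, and Hoeffding's lemma makes
  \<open>exp (l * deviation - l\<^sup>2 / 8 * play_count)\<close> a supermartingale. A union bound over the arm, the
  round and the number of plays shows that, except with probability at most \<open>1 / 2 ^ i\<close>, all averages in the
  phase are within their confidence radius. In that case a played arm has gap at most three times its radius, since
  either a fresh arm or an arm covering a near-optimal one has index at least the best mean. This
  bounds the number of plays of an arm by \<open>72 i / gap\<^sup>2\<close>, and, since an arm is activated only outside
  the confidence balls of the active arms, it makes played arms of the layer of scale \<open>r\<close> pairwise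
  \<open>r / 8\<close>-separated, so there are at most as many of them as sets in a cover. A layer therefore costs
  at most \<open>144 i / r\<close> times its covering number per phase, and the number of phases is logarithmic in \<open>t\<close>.
\<close>

section \<open>Phases\<close>

lemma phase_le_iff: "phase t \<le> i \<longleftrightarrow> t + 2 \<le> 2 ^ Suc i"
proof -
  have sum: "(\<Sum>j=1..i. 2 ^ j) + 2 = (2::nat) ^ Suc i" for i
    by (induction i) auto
  have eq: "phase t = (LEAST i. t + 2 \<le> 2 ^ Suc i)"
    unfolding phase_def sum[symmetric] by simp
  have "t + 2 \<le> 2 ^ Suc t"
    by (induction t) auto
  then have least: "t + 2 \<le> 2 ^ Suc (phase t)"
    unfolding eq by (rule LeastI)
  show ?thesis
  proof
    assume "phase t \<le> i"
    then have "(2::nat) ^ Suc (phase t) \<le> 2 ^ Suc i"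
      by (intro power_increasing) auto
    with least show "t + 2 \<le> 2 ^ Suc i" by linarith
  qed (unfold eq, rule Least_le)
qed

lemma phase_mono: "s \<le> t \<Longrightarrow> phase s \<le> phase t"
  using phase_le_iff[of t "phase t"] by (simp add: phase_le_iff)

lemma phase_pos: "1 \<le> t \<Longrightarrow> 1 \<le> phase t"
  using phase_le_iff[of t 0] by simp

lemma phase_0 [simp]: "phase 0 = 0"
  using phase_le_iff[of 0 0] by simp

lemma phase_pos_imp: "1 \<le> phase s \<Longrightarrow> 1 \<le> s"
  by (cases s) auto

lemma two_power_phase_le: "2 ^ phase t \<le> t + 1"
proof (cases "phase t")
  case (Suc i)
  then show ?thesis using phase_le_iff[of t i] by simp
qed simp

lemma phase_subset: "{s. phase s = i} \<subseteq> {2 ^ i - 1..<2 ^ Suc i - 1}"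
proof
  fix s assume "s \<in> {s. phase s = i}"
  then show "s \<in> {2 ^ i - 1..<2 ^ Suc i - 1}"
    using two_power_phase_le[of s] phase_le_iff[of s i] by auto
qed

lemma finite_phase [simp]: "finite {s. phase s = i}"
  by (rule finite_subset[OF phase_subset]) simp

lemma card_phase_le: "card {s. phase s = i} \<le> 2 ^ i"
  using card_mono[OF _ phase_subset, of i] by simp

text \<open>Phases double in length, and \<open>1 / ln 2\<close> is below \<open>2\<close>.\<close>

lemma phase_le_log: "real (phase t) \<le> 2 * ln (1 + real t)"
proof -
  have "real (phase t) / 2 \<le> real (phase t) * ln 2"
    using mult_left_mono[of "1 / 2" "ln 2 :: real" "real (phase t)"] ln2_ge_two_thirds by simp
  also have "\<dots> = ln (real (2 ^ phase t))"
    by (simp add: ln_realpow)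
  also have "\<dots> \<le> ln (1 + real t)"
    using two_power_phase_le[of t] by (subst ln_le_cancel_iff) (simp_all flip: of_nat_Suc)
  finally show ?thesis by simp
qed

text \<open>\<open>gap_played_le\<close> below speaks only of the arm played in a round. Going back
  to the last play of an arm changes its count by just one, which carries such bounds over to later
  rounds of the phase.\<close>

lemma last_play:
  assumes "{s. s < t \<and> phase s = i \<and> x s = a} \<noteq> {}"
  obtains m where "m < t" "phase m = i" "x m = a"
    "card {s. s < t \<and> phase s = i \<and> x s = a} = Suc (num_plays x m a)"
proof -
  define J where "J = {s. s < t \<and> phase s = i \<and> x s = a}"
  define m where "m = Max J"
  have fin: "finite J" by (simp add: J_def)
  have m: "m \<in> J"
    unfolding m_def using assms fin by (intro Max_in) (auto simp: J_def)
  have "s \<le> m" if "s \<in> J" for s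
    using Max_ge[OF fin that] by (simp add: m_def)
  then have "J = insert m (plays_before x m a)"
    using m unfolding plays_before_def J_def by (auto simp: order.strict_iff_order)
  moreover have "m \<notin> plays_before x m a" "finite (plays_before x m a)"
    by (auto simp: plays_before_def)
  ultimately have "card J = Suc (num_plays x m a)"
    by (simp add: num_plays_def)
  with m show thesis using that[of m] unfolding J_def by blast
qed

section \<open>Confident phases\<close>

context relaxed_lipschitz_mab
begin

lemma arms_nonempty: "X \<noteq> {}"
  using relaxed_lipschitz[of 1] by auto

lemma bdd_above_mean: "bdd_above (\<mu> ` X)"
  using mean_range by (intro bdd_aboveI[of _ 1]) auto

lemma best_mean_le_1: "best_mean X \<mu> \<le> 1"
  unfolding best_mean_def using arms_nonempty mean_range by (intro cSUP_least) auto

lemma gap_nonneg: "a \<in> X \<Longrightarrow> 0 \<le> gap X \<mu> a"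
  unfolding gap_def best_mean_def using bdd_above_mean by (simp add: cSUP_upper)

lemma gap_le_1: "a \<in> X \<Longrightarrow> gap X \<mu> a \<le> 1"
  using best_mean_le_1 mean_range[of a] by (simp add: gap_def)

text \<open>The scale is the power of \<open>1/2\<close> preceding the first one below the gap. That
  first exponent is positive because gaps are at most \<open>1\<close>.\<close>

lemma gap_in_layer:
  assumes "a \<in> X" "0 < gap X \<mu> a"
  obtains r where "r \<in> dyadic_scales" "a \<in> gap_layer X \<mu> r"
proof -
  let ?g = "gap X \<mu> a"
  let ?k = "LEAST k. (1/2::real) ^ k < ?g"
  have ex: "\<exists>k. (1/2::real) ^ k < ?g"
    using real_arch_pow_inv[OF assms(2), of "1/2"] by simp
  then have k: "(1/2::real) ^ ?k < ?g" by (rule LeastI_ex)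
  then obtain i where i: "?k = Suc i"
    using gap_le_1[OF assms(1)] by (cases ?k) auto
  then have "\<not> (1/2::real) ^ i < ?g"
    using not_less_Least[of i "\<lambda>k. (1/2::real) ^ k < ?g"] by simp
  then have "a \<in> gap_layer X \<mu> (1 / 2 ^ i)"
    using k assms unfolding i gap_layer_def by (simp add: power_one_over)
  then show thesis using that by (auto simp: dyadic_scales_def)
qed

end

text \<open>Everything random is packed into this property of a single trajectory, so that the
  analysis of a phase becomes deterministic. It ranges over unplayed arms too, whose average is
  \<open>0\<close> by convention.\<close>

definition confident :: "'a set \<Rightarrow> ('a \<Rightarrow> real) \<Rightarrow> (nat \<Rightarrow> 'a) \<Rightarrow> (nat \<Rightarrow> real) \<Rightarrow> nat \<Rightarrow> bool" where
  "confident X \<mu> x y i \<longleftrightarrow>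
     (\<forall>t a. phase t = i \<longrightarrow> a \<in> X \<longrightarrow> \<bar>avg_reward x y t a - \<mu> a\<bar> \<le> conf_radius x t a)"

section \<open>Deterministic analysis of one trajectory\<close>

locale zooming_trajectory = relaxed_lipschitz_mab X D \<mu> P
  for X :: "'a set" and D \<mu> P +
  fixes z :: "nat \<Rightarrow> 'a option" and x :: "nat \<Rightarrow> 'a" and y :: "nat \<Rightarrow> real"
  assumes run: "zooming_run X D z x y"
begin

lemma activated_uncovered: "1 \<le> t \<Longrightarrow> z t = Some a \<Longrightarrow> a \<in> uncovered X D x z t"
  using run unfolding zooming_run_def by (auto dest!: spec[of _ t] split: if_splits)

lemma all_covered: "1 \<le> t \<Longrightarrow> z t = None \<Longrightarrow> uncovered X D x z t = {}"
  using run unfolding zooming_run_def by (auto dest!: spec[of _ t] split: if_splits)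

lemma played_active: "1 \<le> t \<Longrightarrow> x t \<in> active_at_play z t"
  using run unfolding zooming_run_def by blast

lemma played_index: "1 \<le> t \<Longrightarrow> b \<in> active_at_play z t \<Longrightarrow> arm_index x y t b \<le> arm_index x y t (x t)"
  using run unfolding zooming_run_def by blast

lemma played_activated:
  assumes "1 \<le> t"
  obtains s where "1 \<le> s" "s \<le> t" "phase s = phase t" "z s = Some (x t)"
proof -
  have "\<exists>s\<le>t. phase s = phase t \<and> z s = Some (x t)"
    using played_active[OF assms] unfolding active_at_play_def active_before_def
    by (auto intro: less_imp_le)
  then obtain s where s: "s \<le> t" "phase s = phase t" "z s = Some (x t)" by blast
  moreover have "1 \<le> s"
    using s(2) phase_pos[OF assms] by (cases s) auto
  ultimately show thesis using that by blast
qed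

lemma active_in: "1 \<le> phase t \<Longrightarrow> a \<in> active_before z t \<Longrightarrow> a \<in> X"
proof -
  assume "1 \<le> phase t" "a \<in> active_before z t"
  then obtain s where s: "phase s = phase t" "z s = Some a"
    by (auto simp: active_before_def)
  with \<open>1 \<le> phase t\<close> have "1 \<le> s" by (cases s) auto
  from activated_uncovered[OF this s(2)] show "a \<in> X" by (simp add: uncovered_def)
qed

lemma played_in:
  assumes "1 \<le> t" shows "x t \<in> X"
proof -
  obtain s where "1 \<le> s" "z s = Some (x t)" using played_activated[OF assms] .
  from activated_uncovered[OF this] show ?thesis by (simp add: uncovered_def)
qed

text \<open>The radius is then at least \<open>sqrt (8 / 2)\<close>. The threshold \<open>1\<close>
  matters because means and gaps never exceed it.\<close>

lemma conf_radius_fresh: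
  assumes "1 \<le> t" "num_plays x t a \<le> 1"
  shows "1 \<le> conf_radius x t a"
proof -
  have "1 + real (num_plays x t a) \<le> 8 * real (phase t)"
    using phase_pos[OF assms(1)] assms(2) by linarith
  then show ?thesis by (simp add: conf_radius_def le_divide_eq)
qed

text \<open>An arm already played in the phase is active, and an active arm lies in its own ball:
  the radius is positive and \<open>D a a = 0\<close>. Hence it cannot be uncovered.\<close>

lemma activated_fresh:
  assumes t: "1 \<le> t" and a: "z t = Some a"
  shows "num_plays x t a = 0"
proof (rule ccontr)
  assume "num_plays x t a \<noteq> 0"
  then have "plays_before x t a \<noteq> {}" by (auto simp: num_plays_def)
  then obtain s where s: "s < t" "phase s = phase t" "x s = a"
    by (auto simp: plays_before_def)
  with phase_pos[OF t] have "1 \<le> s" by (cases s) auto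
  then obtain u where "u \<le> s" "phase u = phase s" "z u = Some (x s)"
    by (rule played_activated)
  with s have act: "a \<in> active_before z t"
    by (auto simp: active_before_def intro!: exI[of _ u])
  have aX: "a \<in> X" and "a \<notin> arm_ball X D a (conf_radius x t a)"
    using activated_uncovered[OF t a] act by (auto simp: uncovered_def)
  moreover have "0 < conf_radius x t a"
    using phase_pos[OF t] by (simp add: conf_radius_def)
  ultimately show False
    using D_refl[OF aX] by (simp add: arm_ball_def)
qed

text \<open>
  If an arm is activated in round \<open>t\<close>, arms far from it may stay uncovered, so the near-optimal arm
  \<open>x0\<close> cannot be used; but the index of a fresh arm exceeds \<open>1\<close>, hence the best mean.
\<close>

lemma gap_played_le:
  assumes t: "1 \<le> t" and conf: "confident X \<mu> x y (phase t)"
  shows "gap X \<mu> (x t) \<le> 3 * conf_radius x t (x t)"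
proof -
  let ?r = "conf_radius x t"
  have est: "\<bar>avg_reward x y t a - \<mu> a\<bar> \<le> ?r a" if "a \<in> X" for a
    using conf that by (simp add: confident_def)
  have "best_mean X \<mu> - \<epsilon> \<le> arm_index x y t (x t)" if \<epsilon>: "0 < \<epsilon>" for \<epsilon>
  proof (cases "z t")
    case (Some w)
    have "avg_reward x y t w = 0" "1 \<le> ?r w"
      using activated_fresh[OF t Some] conf_radius_fresh[OF t, of w]
      by (auto simp: avg_reward_def)
    then have "best_mean X \<mu> \<le> arm_index x y t w"
      using best_mean_le_1 by (simp add: arm_index_def)
    also have "\<dots> \<le> arm_index x y t (x t)"
      using Some by (intro played_index[OF t]) (simp add: active_at_play_def)
    finally show ?thesis using \<epsilon> by simp
  next
    case None
    obtain x0 where x0: "x0 \<in> X" "\<forall>a\<in>X. ennreal (gap X \<mu> a) \<le> D a x0 + ennreal \<epsilon>"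
      using relaxed_lipschitz[OF \<epsilon>] by blast
    then obtain v where v: "v \<in> active_before z t" "D v x0 < ennreal (?r v)"
      using all_covered[OF t None] by (auto simp: uncovered_def arm_ball_def)
    have vX: "v \<in> X" using active_in[OF phase_pos[OF t] v(1)] .
    have "ennreal (gap X \<mu> v) \<le> D v x0 + ennreal \<epsilon>"
      using x0(2) vX by blast
    also have "\<dots> \<le> ennreal (?r v) + ennreal \<epsilon>"
      using v(2) by (intro add_right_mono) simp
    finally have "ennreal (gap X \<mu> v) \<le> ennreal (?r v) + ennreal \<epsilon>" .
    then have "gap X \<mu> v \<le> ?r v + \<epsilon>"
      using \<epsilon> by (simp add: conf_radius_def flip: ennreal_plus)
    \<comment> \<open>Of the two radii in the index of \<open>v\<close>, one pays for its estimation
      error and the other for its gap.\<close>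
    then have "best_mean X \<mu> - \<epsilon> \<le> arm_index x y t v"
      using est[OF vX] by (simp add: gap_def arm_index_def)
    also have "\<dots> \<le> arm_index x y t (x t)"
      using v(1) by (intro played_index[OF t]) (simp add: active_at_play_def)
    finally show ?thesis .
  qed
  then have "best_mean X \<mu> \<le> arm_index x y t (x t)"
    by (metis diff_le_eq field_le_epsilon)
  \<comment> \<open>The index exceeds the true mean by at most the estimation error plus two radii,
    which gives the factor \<open>3\<close>.\<close>
  then show ?thesis
    using est[OF played_in[OF t]] by (simp add: arm_index_def gap_def)
qed

text \<open>
  The radius shrinks by at most the factor \<open>sqrt (2 / 3)\<close> after the last play, and \<open>3 * sqrt (3 / 2) < 4\<close>;
  after a single play the factor would be \<open>sqrt (1 / 2)\<close>, but then the radius is still at least \<open>1\<close>.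
\<close>

lemma gap_le_conf_radius:
  assumes t: "1 \<le> t" and conf: "confident X \<mu> x y (phase t)" and a: "a \<in> X"
  shows "gap X \<mu> a \<le> 4 * conf_radius x t a"
proof (cases "num_plays x t a \<le> 1")
  case True
  then show ?thesis
    using conf_radius_fresh[OF t True] gap_le_1[OF a] by linarith
next
  case False
  then have "{s. s < t \<and> phase s = phase t \<and> x s = a} \<noteq> {}"
    unfolding num_plays_def plays_before_def by force
  then obtain m where m: "phase m = phase t" "x m = a"
    and n: "num_plays x t a = Suc (num_plays x m a)"
    unfolding num_plays_def[of x t] plays_before_def by (rule last_play) blast
  have "1 \<le> m" using m(1) phase_pos[OF t] by (cases m) auto
  then have "gap X \<mu> a \<le> 3 * conf_radius x m a"
    using gap_played_le[of m] conf m by simp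
  also have "\<dots> = sqrt (9 * (8 * real (phase t) / (1 + real (num_plays x m a))))"
    unfolding conf_radius_def m(1) real_sqrt_mult[of 9] by simp
  also have "\<dots> \<le> sqrt (16 * (8 * real (phase t) / (1 + real (num_plays x t a))))"
  proof -
    \<comment> \<open>The case assumption makes \<open>num_plays x m a\<close> at least
      \<open>1\<close>; for \<open>0\<close> this would read \<open>18 \<le> 16\<close>.\<close>
    have "9 * (2 + real (num_plays x m a)) \<le> 16 * (1 + real (num_plays x m a))"
      using False n by simp
    then have "8 * real (phase t) * (9 * (2 + real (num_plays x m a)))
        \<le> 8 * real (phase t) * (16 * (1 + real (num_plays x m a)))"
      by (intro mult_left_mono) auto
    then show ?thesis unfolding n by (simp add: divide_simps mult_ac)
  qed
  also have "\<dots> = 4 * conf_radius x t a"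
    unfolding conf_radius_def real_sqrt_mult[of 16] by simp
  finally show ?thesis .
qed

text \<open>The arm activated second was outside the ball of the first, whose radius was still at
  least a quarter of the gap of the first. Either arm may be the first, so \<open>c\<close> bounds
  both gaps and symmetry of \<open>D\<close> settles the order.\<close>

lemma played_separated:
  assumes conf: "confident X \<mu> x y i" and s: "1 \<le> s" "phase s = i" and t: "1 \<le> t" "phase t = i"
    and neq: "x s \<noteq> x t" and c: "c < gap X \<mu> (x s)" "c < gap X \<mu> (x t)"
  shows "ennreal (c / 4) \<le> D (x s) (x t)"
proof -
  have later: "ennreal (c / 4) \<le> D u v"
    if "p < q" "z p = Some u" "z q = Some v" "phase p = i" "phase q = i" "1 \<le> q" "u \<in> X" "v \<in> X"
      "c < gap X \<mu> u" for p q u v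
  proof -
    have "u \<in> active_before z q"
      using that by (auto simp: active_before_def)
    then have "v \<notin> arm_ball X D u (conf_radius x q u)"
      using activated_uncovered[of q v] that by (auto simp: uncovered_def)
    then have "ennreal (conf_radius x q u) \<le> D u v"
      using that by (simp add: arm_ball_def not_less)
    moreover have "c / 4 \<le> conf_radius x q u"
      using gap_le_conf_radius[of q u] that conf by simp
    ultimately show ?thesis
      using order_trans[OF ennreal_leI] by simp
  qed
  obtain p where p: "1 \<le> p" "phase p = i" "z p = Some (x s)"
    using played_activated[OF s(1)] unfolding s(2) .
  obtain q where q: "1 \<le> q" "phase q = i" "z q = Some (x t)"
    using played_activated[OF t(1)] unfolding t(2) .
  \<comment> \<open>A round activates at most one arm.\<close>
  have "p \<noteq> q" using p q neq by auto
  then consider "p < q" | "q < p" by linarith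
  then show ?thesis
  proof cases
    case 1
    then show ?thesis
      using p q c played_in[OF s(1)] played_in[OF t(1)] by (intro later[of p q]) auto
  next
    case 2
    then have "ennreal (c / 4) \<le> D (x t) (x s)"
      using p q c played_in[OF s(1)] played_in[OF t(1)] by (intro later[of q p]) auto
    then show ?thesis using D_sym[OF played_in[OF s(1)] played_in[OF t(1)]] by simp
  qed
qed

text \<open>At the last play, squaring \<open>gap \<le> 3 * radius\<close> gives
  \<open>9 * 8 * i\<close> divided by the total number of plays, hence \<open>72\<close>.\<close>

lemma plays_gap_le:
  assumes conf: "confident X \<mu> x y i" and i: "1 \<le> i" and a: "a \<in> X" "0 < gap X \<mu> a"
  shows "real (card {s. s < t \<and> phase s = i \<and> x s = a}) * gap X \<mu> a \<le> 72 * real i / gap X \<mu> a"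
proof (cases "{s. s < t \<and> phase s = i \<and> x s = a} = {}")
  case False
  then obtain m where m: "phase m = i" "x m = a"
    and n: "card {s. s < t \<and> phase s = i \<and> x s = a} = Suc (num_plays x m a)"
    by (rule last_play) blast
  have "1 \<le> m" using m(1) i by (cases m) auto
  then have "gap X \<mu> a \<le> 3 * conf_radius x m a"
    using gap_played_le[of m] conf m by simp
  then have "(gap X \<mu> a)\<^sup>2 \<le> (3 * conf_radius x m a)\<^sup>2"
    using a by (intro power_mono) auto
  also have "\<dots> = 72 * real i / (1 + real (num_plays x m a))"
    by (simp add: conf_radius_def m power_mult_distrib)
  finally have "real (Suc (num_plays x m a)) * (gap X \<mu> a)\<^sup>2 \<le> 72 * real i"
    by (simp add: le_divide_eq mult.commute)
  then have "real (Suc (num_plays x m a)) * gap X \<mu> a * gap X \<mu> a \<le> 72 * real i"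
    by (simp add: power2_eq_square mult.assoc)
  then show ?thesis
    using a unfolding n by (simp only: le_divide_eq if_True)
next
  case True
  show ?thesis unfolding True using a by simp
qed

text \<open>Choosing for each played arm a cover set containing it is injective: two arms in one set
  would be closer than \<open>r / 8\<close>, whereas \<open>played_separated\<close> with
  \<open>c = r / 2\<close> keeps them at least that far apart.\<close>

lemma card_played_layer_le:
  assumes conf: "confident X \<mu> x y i" and i: "1 \<le> i"
    and C: "finite \<C>" "\<And>S. S \<in> \<C> \<Longrightarrow> set_diam D S < ennreal (r / 8)" "gap_layer X \<mu> r \<subseteq> \<Union>\<C>"
  shows "card (x ` {s. phase s = i} \<inter> gap_layer X \<mu> r) \<le> card \<C>"
proof -
  let ?A = "x ` {s. phase s = i} \<inter> gap_layer X \<mu> r"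
  have "\<exists>S\<in>\<C>. a \<in> S" if "a \<in> ?A" for a
    using that C(3) by auto
  then obtain f where f: "\<And>a. a \<in> ?A \<Longrightarrow> f a \<in> \<C>" "\<And>a. a \<in> ?A \<Longrightarrow> a \<in> f a"
    by metis
  have "inj_on f ?A"
  proof (rule inj_onI, rule ccontr)
    fix a b assume ab: "a \<in> ?A" "b \<in> ?A" "f a = f b" "a \<noteq> b"
    then obtain s t where st: "phase s = i" "x s = a" "phase t = i" "x t = b" by auto
    have pos: "1 \<le> s" "1 \<le> t"
      using st i by (auto intro!: Suc_leI gr0I)
    have "ennreal (r / 2 / 4) \<le> D a b"
      using played_separated[OF conf pos(1) st(1) pos(2) st(3), of "r / 2"] st ab
      by (auto simp: gap_layer_def)
    also have "D a b \<le> set_diam D (f a)"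
      unfolding set_diam_def using f(2)[OF ab(1)] f(2)[OF ab(2)] ab(3)
      by (intro SUP_upper2[of a] SUP_upper) auto
    also have "\<dots> < ennreal (r / 8)" using C(2) f(1) ab by blast
    finally show False by simp
  qed
  then show ?thesis
    using f(1) C(1) by (intro card_inj_on_le[of f]) auto
qed

text \<open>A gap up to \<open>\<rho>\<close> is charged to its round, a larger one to its layer.
  Covers are given as a family \<open>\<C>\<close>, which keeps the bound real-valued. Cutting
  \<open>J\<close> at \<open>t\<close> accounts for an unfinished last phase.\<close>

lemma phase_regret_confident:
  fixes t :: nat
  assumes conf: "confident X \<mu> x y i" and i: "1 \<le> i" and \<rho>: "0 < \<rho>"
    and R: "finite R" "\<And>r. r \<in> R \<longleftrightarrow> r \<in> dyadic_scales \<and> \<rho> \<le> r"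
    and C: "\<And>r. r \<in> R \<Longrightarrow> finite (\<C> r)"
      "\<And>r S. r \<in> R \<Longrightarrow> S \<in> \<C> r \<Longrightarrow> set_diam D S < ennreal (r / 8)"
      "\<And>r. r \<in> R \<Longrightarrow> gap_layer X \<mu> r \<subseteq> \<Union>(\<C> r)"
  defines "J \<equiv> {s. s < t \<and> phase s = i}"
  shows "(\<Sum>s\<in>J. gap X \<mu> (x s)) \<le> \<rho> * real (card J) + 144 * real i * (\<Sum>r\<in>R. real (card (\<C> r)) / r)"
proof -
  let ?g = "gap X \<mu>"
  have fin: "finite J" by (simp add: J_def)
  have pos: "1 \<le> s" if "s \<in> J" for s
    using that i by (cases s) (auto simp: J_def)
  have ind_nonneg: "0 \<le> ?g (x s) * indicator (gap_layer X \<mu> r) (x s)" if "s \<in> J" for s r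
    using gap_nonneg[OF played_in[OF pos[OF that]]] by simp
  have layer: "(\<Sum>s\<in>J. ?g (x s) * indicator (gap_layer X \<mu> r) (x s)) \<le> 144 * real i * (real (card (\<C> r)) / r)"
    if r: "r \<in> R" for r
  proof -
    have r0: "0 < r" using R(2)[of r] r \<rho> by simp
    let ?A = "x ` J \<inter> gap_layer X \<mu> r"
    \<comment> \<open>Regroup the rounds by the arm played, so that each arm of the layer
      contributes its play count times its gap.\<close>
    have "(\<Sum>s\<in>J. ?g (x s) * indicator (gap_layer X \<mu> r) (x s))
        = (\<Sum>a\<in>x ` J. \<Sum>s\<in>{s\<in>J. x s = a}. ?g (x s) * indicator (gap_layer X \<mu> r) (x s))"
      by (rule sum.image_gen[OF fin])
    also have "\<dots> = (\<Sum>a\<in>x ` J. (real (card {s\<in>J. x s = a}) * ?g a) * indicator (gap_layer X \<mu> r) a)"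
      by (intro sum.cong refl) simp
    also have "\<dots> = (\<Sum>a\<in>?A. real (card {s\<in>J. x s = a}) * ?g a)"
      using fin by (simp add: sum.inter_restrict indicator_def)
    also have "\<dots> \<le> (\<Sum>a\<in>?A. 144 * real i / r)"
    proof (rule sum_mono)
      fix a assume "a \<in> ?A"
      then have a: "a \<in> X" "r / 2 < ?g a" by (auto simp: gap_layer_def)
      then have "real (card {s\<in>J. x s = a}) * ?g a \<le> 72 * real i / ?g a"
        using plays_gap_le[OF conf i a(1), of t] r0 by (simp add: J_def conj_assoc)
      also have "\<dots> \<le> 72 * real i / (r / 2)"
        using a r0 by (intro divide_left_mono) auto
      finally show "real (card {s\<in>J. x s = a}) * ?g a \<le> 144 * real i / r" by simp
    qed
    also have "\<dots> = real (card ?A) * (144 * real i / r)" by simp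
    also have "\<dots> \<le> real (card (\<C> r)) * (144 * real i / r)"
    proof (rule mult_right_mono)
      have "card ?A \<le> card (x ` {s. phase s = i} \<inter> gap_layer X \<mu> r)"
        by (intro card_mono) (auto simp: J_def)
      also have "\<dots> \<le> card (\<C> r)"
        using C r by (intro card_played_layer_le[OF conf i]) auto
      finally show "real (card ?A) \<le> real (card (\<C> r))" by simp
    qed (use r0 in simp)
    finally show ?thesis by (simp add: mult_ac)
  qed
  have "?g (x s) \<le> \<rho> + (\<Sum>r\<in>R. ?g (x s) * indicator (gap_layer X \<mu> r) (x s))" if s: "s \<in> J" for s
  proof (cases "?g (x s) \<le> \<rho>")
    case True
    then show ?thesis using ind_nonneg[OF s] by (simp add: add_increasing2 sum_nonneg)
  next
    case False
    then have "0 < ?g (x s)" using \<rho> by linarith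
    then obtain r where r: "r \<in> dyadic_scales" "x s \<in> gap_layer X \<mu> r"
      using gap_in_layer[OF played_in[OF pos[OF s]]] by blast
    \<comment> \<open>The scale of a layer bounds its gaps from above, so it exceeds
      \<open>\<rho>\<close>.\<close>
    then have "r \<in> R" using False R(2) by (auto simp: gap_layer_def)
    then have "?g (x s) * indicator (gap_layer X \<mu> r) (x s) \<le> (\<Sum>r\<in>R. ?g (x s) * indicator (gap_layer X \<mu> r) (x s))"
      using R(1) ind_nonneg[OF s] by (intro member_le_sum) auto
    then show ?thesis using r \<rho> by simp
  qed
  then have "(\<Sum>s\<in>J. ?g (x s)) \<le> (\<Sum>s\<in>J. \<rho> + (\<Sum>r\<in>R. ?g (x s) * indicator (gap_layer X \<mu> r) (x s)))"
    by (rule sum_mono)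
  also have "\<dots> = \<rho> * real (card J) + (\<Sum>r\<in>R. \<Sum>s\<in>J. ?g (x s) * indicator (gap_layer X \<mu> r) (x s))"
    by (subst sum.swap[of _ J R]) (simp add: sum.distrib)
  also have "\<dots> \<le> \<rho> * real (card J) + (\<Sum>r\<in>R. 144 * real i * (real (card (\<C> r)) / r))"
    by (intro add_left_mono sum_mono layer)
  finally show ?thesis by (simp add: sum_distrib_left)
qed

end

section \<open>Concentration\<close>

context bandit_process
begin

lemma reward_measurable [measurable]:
  assumes "1 \<le> t" shows "y t \<in> borel_measurable M"
  using reward_adapted[of t "Suc t"] F_subalgebra assms measurable_from_subalg by blast

text \<open>\<open>reward_law\<close> treats indicators only; the standard induction on nonnegative
  measurable functions extends it, with a weight \<open>W\<close> known before the reward.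
  Nonnegative integrals make integrability conditions unnecessary.\<close>

lemma nn_integral_reward:
  fixes W :: "'w \<Rightarrow> ennreal" and h :: "real \<Rightarrow> ennreal"
  assumes t: "1 \<le> t" and W: "W \<in> borel_measurable (F t)" and h: "h \<in> borel_measurable borel"
  shows "(\<integral>\<^sup>+\<omega>. W \<omega> * h (y t \<omega>) \<partial>M) = (\<integral>\<^sup>+\<omega>. W \<omega> * (\<integral>\<^sup>+v. h v \<partial>P (x t \<omega>)) \<partial>M)"
proof -
  interpret finite_measure_subalgebra M "F t"
    using F_subalgebra by unfold_locales
  note [measurable] = W measurable_from_subalg[OF F_subalgebra W] reward_measurable[OF t]
  have K [measurable]: "(\<lambda>\<omega>. P (x t \<omega>)) \<in> F t \<rightarrow>\<^sub>M subprob_algebra borel"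
    by (rule measurable_prob_algebraD[OF arm_law_measurable[OF t]])
  have KM [measurable]: "(\<lambda>\<omega>. P (x t \<omega>)) \<in> M \<rightarrow>\<^sub>M subprob_algebra borel"
    by (rule measurable_from_subalg[OF F_subalgebra K])
  have setsP: "sets (P (x t \<omega>)) = sets borel" if "\<omega> \<in> space M" for \<omega>
    using measurable_space[OF KM that] by (simp add: space_subprob_algebra)
  have prob: "prob_space (P (x t \<omega>))" if "\<omega> \<in> space M" for \<omega>
    using measurable_space[OF arm_law_measurable[OF t]] that subalg
    by (auto simp: space_prob_algebra subalgebra_def)
  have nnM [measurable]: "(\<lambda>\<omega>. \<integral>\<^sup>+v. g v \<partial>P (x t \<omega>)) \<in> borel_measurable M"
    if "g \<in> borel_measurable borel" for g :: "real \<Rightarrow> ennreal"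
    by (rule measurable_compose[OF KM nn_integral_measurable_subprob_algebra[OF that]])
  show ?thesis
    using h
  proof (induction rule: borel_measurable_induct)
    case (cong f g)
    then show ?case by simp
  next
    case (set B)
    then have [measurable]: "B \<in> sets borel" by simp
    let ?c = "nn_cond_exp M (F t) (\<lambda>\<omega>. indicator B (y t \<omega>))"
    \<comment> \<open>\<open>real_cond_exp\<close> is a difference of two \<open>nn_cond_exp\<close>
      terms. For an indicator the negative part vanishes and the positive part is finite, so
      \<open>reward_law\<close> determines \<open>?c\<close>.\<close>
    have zero: "AE \<omega> in M. nn_cond_exp M (F t) (\<lambda>\<omega>. ennreal (- indicat_real B (y t \<omega>))) \<omega> = 0"
      using nn_cond_exp_F_meas[of "\<lambda>_. 0"] by (simp add: ennreal_neg)
    have fin: "AE \<omega> in M. ?c \<omega> \<le> 1"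
    proof -
      have "AE \<omega> in M. ?c \<omega> \<le> nn_cond_exp M (F t) (\<lambda>_. 1) \<omega>"
        by (rule nn_cond_exp_mono) (auto simp: indicator_def)
      moreover have "AE \<omega> in M. 1 = nn_cond_exp M (F t) (\<lambda>_. 1) \<omega>"
        by (rule nn_cond_exp_F_meas) simp
      ultimately show ?thesis by eventually_elim simp
    qed
    have eq: "AE \<omega> in M. ?c \<omega> = emeasure (P (x t \<omega>)) B"
      using reward_law[OF t \<open>B \<in> sets borel\<close>] zero fin AE_space
    proof eventually_elim
      case (elim \<omega>)
      interpret p: prob_space "P (x t \<omega>)" using prob elim by simp
      have "enn2real (?c \<omega>) = measure (P (x t \<omega>)) B"
        using elim by (simp add: real_cond_exp_def ennreal_indicator)
      moreover have "?c \<omega> < \<top>"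
        using elim(3) by (metis ennreal_one_less_top le_less_trans)
      ultimately show ?case
        by (metis ennreal_enn2real p.emeasure_eq_measure)
    qed
    have "(\<integral>\<^sup>+\<omega>. W \<omega> * indicator B (y t \<omega>) \<partial>M) = (\<integral>\<^sup>+\<omega>. W \<omega> * ?c \<omega> \<partial>M)"
      by (rule nn_cond_exp_intg[symmetric]) measurable
    also have "\<dots> = (\<integral>\<^sup>+\<omega>. W \<omega> * emeasure (P (x t \<omega>)) B \<partial>M)"
      by (rule nn_integral_cong_AE) (use eq in eventually_elim, simp)
    also have "\<dots> = (\<integral>\<^sup>+\<omega>. W \<omega> * (\<integral>\<^sup>+v. indicator B v \<partial>P (x t \<omega>)) \<partial>M)"
      by (rule nn_integral_cong) (simp add: setsP)
    finally show ?case .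
  next
    case (mult f c)
    note [measurable] = mult(2)
    have "(\<integral>\<^sup>+\<omega>. W \<omega> * (c * f (y t \<omega>)) \<partial>M) = c * (\<integral>\<^sup>+\<omega>. W \<omega> * f (y t \<omega>) \<partial>M)"
      by (subst nn_integral_cmult[symmetric]) (auto simp: mult_ac)
    also have "\<dots> = (\<integral>\<^sup>+\<omega>. c * (W \<omega> * (\<integral>\<^sup>+v. f v \<partial>P (x t \<omega>))) \<partial>M)"
      unfolding mult by (subst nn_integral_cmult) auto
    also have "\<dots> = (\<integral>\<^sup>+\<omega>. W \<omega> * (\<integral>\<^sup>+v. c * f v \<partial>P (x t \<omega>)) \<partial>M)"
      by (rule nn_integral_cong)
         (subst nn_integral_cmult, auto simp: mult_ac measurable_cong_sets[OF setsP refl])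
    finally show ?case .
  next
    case (add f g)
    note [measurable] = add(1,3,4)
    have "(\<integral>\<^sup>+\<omega>. W \<omega> * (g (y t \<omega>) + f (y t \<omega>)) \<partial>M) =
        (\<integral>\<^sup>+\<omega>. W \<omega> * g (y t \<omega>) \<partial>M) + (\<integral>\<^sup>+\<omega>. W \<omega> * f (y t \<omega>) \<partial>M)"
      by (subst nn_integral_add[symmetric]) (auto simp: algebra_simps)
    also have "\<dots> = (\<integral>\<^sup>+\<omega>. W \<omega> * (\<integral>\<^sup>+v. g v \<partial>P (x t \<omega>)) + W \<omega> * (\<integral>\<^sup>+v. f v \<partial>P (x t \<omega>)) \<partial>M)"
      unfolding add by (subst nn_integral_add) auto
    also have "\<dots> = (\<integral>\<^sup>+\<omega>. W \<omega> * (\<integral>\<^sup>+v. g v + f v \<partial>P (x t \<omega>)) \<partial>M)"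
      by (rule nn_integral_cong)
         (subst nn_integral_add, auto simp: algebra_simps measurable_cong_sets[OF setsP refl])
    finally show ?case .
  next
    case (seq U)
    note [measurable] = seq(1)
    have "(\<integral>\<^sup>+\<omega>. W \<omega> * (SUP i. U i) (y t \<omega>) \<partial>M) = (\<integral>\<^sup>+\<omega>. (SUP i. W \<omega> * U i (y t \<omega>)) \<partial>M)"
      by (simp add: SUP_mult_left_ennreal image_comp)
    also have "\<dots> = (SUP i. \<integral>\<^sup>+\<omega>. W \<omega> * U i (y t \<omega>) \<partial>M)"
      using seq(3) by (intro nn_integral_monotone_convergence_SUP)
        (auto simp: incseq_def le_fun_def intro!: mult_left_mono)
    also have "\<dots> = (SUP i. \<integral>\<^sup>+\<omega>. W \<omega> * (\<integral>\<^sup>+v. U i v \<partial>P (x t \<omega>)) \<partial>M)"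
      using seq by simp
    also have "\<dots> = (\<integral>\<^sup>+\<omega>. (SUP i. W \<omega> * (\<integral>\<^sup>+v. U i v \<partial>P (x t \<omega>))) \<partial>M)"
      using seq(3) by (intro nn_integral_monotone_convergence_SUP[symmetric])
        (auto simp: incseq_def le_fun_def intro!: mult_left_mono nn_integral_mono)
    also have "\<dots> = (\<integral>\<^sup>+\<omega>. W \<omega> * (\<integral>\<^sup>+v. (SUP i. U i) v \<partial>P (x t \<omega>)) \<partial>M)"
    proof (rule nn_integral_cong)
      fix \<omega> assume "\<omega> \<in> space M"
      then have "(\<integral>\<^sup>+v. (SUP i. U i v) \<partial>P (x t \<omega>)) = (SUP i. \<integral>\<^sup>+v. U i v \<partial>P (x t \<omega>))"
        using seq by (intro nn_integral_monotone_convergence_SUP)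
          (auto simp: measurable_cong_sets[OF setsP refl])
      then show "(SUP i. W \<omega> * (\<integral>\<^sup>+v. U i v \<partial>P (x t \<omega>))) = W \<omega> * (\<integral>\<^sup>+v. (SUP i. U i) v \<partial>P (x t \<omega>))"
        by (simp add: SUP_mult_left_ennreal image_comp)
    qed
    finally show ?case .
  qed
qed

end

text \<open>Hoeffding's lemma covers positive \<open>l\<close>; negative \<open>l\<close> reduces to
  it through the negated reward. Both signs serve the two-sided deviation bound.\<close>

lemma (in relaxed_lipschitz_mab) reward_mgf:
  assumes a: "a \<in> X"
  shows "(\<integral>\<^sup>+v. ennreal (exp (l * (v - \<mu> a))) \<partial>P a) \<le> ennreal (exp (l\<^sup>2 / 8))"
proof -
  interpret prob_space "P a" by (rule reward_prob_space[OF a])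
  have id: "(\<lambda>v. v) \<in> borel_measurable (P a)"
    using reward_sets[OF a] by (simp cong: measurable_cong_sets)
  show ?thesis
  proof (cases l "0::real" rule: linorder_cases)
    case greater
    interpret interval_bounded_random_variable "P a" "\<lambda>v. v" 0 1
      using reward_range[OF a] id by unfold_locales auto
    show ?thesis
      using Hoeffdings_lemma_nn_integral[OF greater] reward_mean[OF a] by simp
  next
    case less
    interpret interval_bounded_random_variable "P a" "\<lambda>v. - v" "-1" 0
      using reward_range[OF a] id by unfold_locales (auto elim!: eventually_mono)
    show ?thesis
      using Hoeffdings_lemma_nn_integral[of "-l"] less reward_mean[OF a]
      by (simp add: algebra_simps)
  next
    case equal
    then show ?thesis by (simp add: emeasure_space_1)
  qed
qed

section \<open>Exponential supermartingales along the plays of one arm\<close>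

locale bandit_instance = relaxed_lipschitz_mab X D \<mu> P + bandit_process M F X P x y
  for X :: "'a set" and D \<mu> P and M :: "'w measure" and F x y
begin

text \<open>With no \<sigma>-algebra on the arms, \<open>\<mu>\<close> cannot simply be composed
  with \<open>x t\<close>; the mean is recovered as an integral against the measurable kernel of
  reward laws.\<close>

lemma mean_measurable_F:
  assumes t: "1 \<le> t"
  shows "(\<lambda>\<omega>. \<mu> (x t \<omega>)) \<in> borel_measurable (F t)"
proof -
  have K: "(\<lambda>\<omega>. P (x t \<omega>)) \<in> F t \<rightarrow>\<^sub>M subprob_algebra borel"
    by (rule measurable_prob_algebraD[OF arm_law_measurable[OF t]])
  have "(\<lambda>\<omega>. enn2real (\<integral>\<^sup>+v. ennreal v \<partial>P (x t \<omega>))) \<in> borel_measurable (F t)"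
    by (intro measurable_compose[OF measurable_compose[OF K nn_integral_measurable_subprob_algebra]]) auto
  moreover have "\<mu> (x t \<omega>) = enn2real (\<integral>\<^sup>+v. ennreal v \<partial>P (x t \<omega>))" if "\<omega> \<in> space (F t)" for \<omega>
  proof -
    have a: "x t \<omega> \<in> X" using arm_in[OF t] that space_F by simp
    have "AE v in P (x t \<omega>). 0 \<le> v" using reward_range[OF a] by eventually_elim simp
    then show ?thesis
      using reward_sets[OF a] reward_mean[OF a]
      by (subst integral_eq_nn_integral[symmetric]) (auto cong: measurable_cong_sets)
  qed
  ultimately show ?thesis by (simp cong: measurable_cong)
qed

lemma F_measurable_mono:
  assumes "f \<in> borel_measurable (F s)" "s \<le> t"
  shows "f \<in> borel_measurable (F t)"
  using assms sets_F_mono[OF assms(2)] by (auto simp: measurable_def space_F)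

text \<open>
  Arms are addressed by a round \<open>s\<close> in which they are played: no measurability of events such as
  \<open>x t \<omega> = a\<close> is available, only of \<open>x s \<omega> = x t \<omega>\<close>.
\<close>

definition same :: "nat \<Rightarrow> nat \<Rightarrow> 'w \<Rightarrow> real" where
  "same s u \<omega> = of_bool (x u \<omega> = x s \<omega>)"

text \<open>Counting starts with round \<open>s\<close> itself. If \<open>s\<close> is the first
  play of its arm in the phase of \<open>t\<close>, this equals \<open>num_plays\<close> at
  \<open>t\<close>.\<close>

definition play_count :: "nat \<Rightarrow> nat \<Rightarrow> 'w \<Rightarrow> real" where
  "play_count s t \<omega> = (\<Sum>u\<in>{s..<t}. same s u \<omega>)"

definition deviation :: "nat \<Rightarrow> nat \<Rightarrow> 'w \<Rightarrow> real" where
  "deviation s t \<omega> = (\<Sum>u\<in>{s..<t}. same s u \<omega> * (y u \<omega> - \<mu> (x u \<omega>)))"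

lemma same_measurable_F:
  assumes "1 \<le> s" "s \<le> t"
  shows "same s t \<in> borel_measurable (F t)"
proof -
  have "same s t \<omega> = indicator {\<omega> \<in> space M. x s \<omega> = x t \<omega>} \<omega>" if "\<omega> \<in> space (F t)" for \<omega>
    using that by (auto simp: same_def indicator_def space_F)
  then show ?thesis
    using borel_measurable_indicator[OF same_arm_measurable[OF assms]] by (simp cong: measurable_cong)
qed

lemma play_count_measurable_F:
  assumes "1 \<le> s" shows "play_count s t \<in> borel_measurable (F t)"
  unfolding play_count_def
  by (intro borel_measurable_sum F_measurable_mono[OF same_measurable_F]) (use assms in auto)

lemma deviation_measurable_F:
  assumes "1 \<le> s" shows "deviation s t \<in> borel_measurable (F t)"
  unfolding deviation_def
  by (intro borel_measurable_sum borel_measurable_times borel_measurable_diff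
        F_measurable_mono[OF same_measurable_F] F_measurable_mono[OF mean_measurable_F] reward_adapted)
     (use assms in auto)

lemma play_count_measurable [measurable]: "1 \<le> s \<Longrightarrow> play_count s t \<in> borel_measurable M"
  using play_count_measurable_F F_subalgebra measurable_from_subalg by blast

lemma deviation_measurable [measurable]: "1 \<le> s \<Longrightarrow> deviation s t \<in> borel_measurable M"
  using deviation_measurable_F F_subalgebra measurable_from_subalg by blast

lemma mean_measurable [measurable]: "1 \<le> t \<Longrightarrow> (\<lambda>\<omega>. \<mu> (x t \<omega>)) \<in> borel_measurable M"
  using mean_measurable_F F_subalgebra measurable_from_subalg by blast

text \<open>A round playing another arm leaves the exponential unchanged. A round playing the arm
  multiplies it by a factor of conditional mean at most \<open>1\<close>, by
  \<open>reward_mgf\<close>.\<close>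

lemma exp_supermartingale:
  assumes s: "1 \<le> s" and "s \<le> t"
  shows "(\<integral>\<^sup>+\<omega>. ennreal (exp (l * deviation s t \<omega> - l\<^sup>2 / 8 * play_count s t \<omega>)) \<partial>M) \<le> 1"
  using \<open>s \<le> t\<close>
proof (induction t rule: dec_induct)
  case base
  then show ?case by (simp add: deviation_def play_count_def emeasure_space_1)
next
  case (step t)
  have t: "1 \<le> t" using s step by simp
  let ?V = "\<lambda>\<omega>. ennreal (exp (l * deviation s t \<omega> - l\<^sup>2 / 8 * play_count s t \<omega>))"
  let ?A = "\<lambda>\<omega>. ennreal (same s t \<omega>)" and ?B = "\<lambda>\<omega>. ennreal (1 - same s t \<omega>)"
  note [measurable] = deviation_measurable_F[OF s, of t] play_count_measurable_F[OF s, of t]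
    same_measurable_F[OF s step(1)] mean_measurable_F[OF t] reward_measurable[OF t]
    measurable_from_subalg[OF F_subalgebra same_measurable_F[OF s step(1)]]
    mean_measurable[OF t] play_count_measurable[OF s] deviation_measurable[OF s]
  \<comment> \<open>\<open>W\<close> gathers all that is known before the reward of round
    \<open>t\<close>, so that only \<open>exp (l * y t \<omega>)\<close> remains to be integrated
    against the reward law.\<close>
  define W where "W \<omega> = ?A \<omega> * ?V \<omega> * ennreal (exp (- l\<^sup>2 / 8 - l * \<mu> (x t \<omega>)))" for \<omega>
  have W: "W \<in> borel_measurable (F t)" unfolding W_def by measurable
  have WM [measurable]: "W \<in> borel_measurable M" unfolding W_def by measurable
  have split: "ennreal (exp (l * deviation s (Suc t) \<omega> - l\<^sup>2 / 8 * play_count s (Suc t) \<omega>))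
      = ?B \<omega> * ?V \<omega> + W \<omega> * ennreal (exp (l * y t \<omega>))" for \<omega>
    using step(1) unfolding W_def
    by (auto simp: deviation_def play_count_def same_def algebra_simps simp flip: ennreal_mult exp_add)
  have kernel: "W \<omega> * (\<integral>\<^sup>+v. ennreal (exp (l * v)) \<partial>P (x t \<omega>)) \<le> ?A \<omega> * ?V \<omega>" if \<omega>: "\<omega> \<in> space M" for \<omega>
  proof -
    let ?a = "x t \<omega>"
    have a: "?a \<in> X" using arm_in[OF t \<omega>] .
    have "ennreal (exp (- l\<^sup>2 / 8 - l * \<mu> ?a)) * (\<integral>\<^sup>+v. ennreal (exp (l * v)) \<partial>P ?a)
        = ennreal (exp (- l\<^sup>2 / 8)) * (\<integral>\<^sup>+v. ennreal (exp (l * (v - \<mu> ?a))) \<partial>P ?a)"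
      using reward_sets[OF a]
      by (subst (1 2) nn_integral_cmult[symmetric])
         (auto intro!: nn_integral_cong simp: algebra_simps simp flip: ennreal_mult exp_add cong: measurable_cong_sets)
    also have "\<dots> \<le> ennreal (exp (- l\<^sup>2 / 8)) * ennreal (exp (l\<^sup>2 / 8))"
      by (intro mult_left_mono reward_mgf[OF a]) simp
    also have "\<dots> = 1" by (simp flip: ennreal_mult exp_add)
    finally have "?A \<omega> * ?V \<omega> * (ennreal (exp (- l\<^sup>2 / 8 - l * \<mu> ?a)) * (\<integral>\<^sup>+v. ennreal (exp (l * v)) \<partial>P ?a))
        \<le> ?A \<omega> * ?V \<omega> * 1"
      by (intro mult_left_mono) auto
    then show ?thesis by (simp add: W_def mult.assoc)
  qed
  have "(\<integral>\<^sup>+\<omega>. ennreal (exp (l * deviation s (Suc t) \<omega> - l\<^sup>2 / 8 * play_count s (Suc t) \<omega>)) \<partial>M)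
      = (\<integral>\<^sup>+\<omega>. ?B \<omega> * ?V \<omega> \<partial>M) + (\<integral>\<^sup>+\<omega>. W \<omega> * ennreal (exp (l * y t \<omega>)) \<partial>M)"
    unfolding split by (rule nn_integral_add) measurable
  also have "(\<integral>\<^sup>+\<omega>. W \<omega> * ennreal (exp (l * y t \<omega>)) \<partial>M)
      = (\<integral>\<^sup>+\<omega>. W \<omega> * (\<integral>\<^sup>+v. ennreal (exp (l * v)) \<partial>P (x t \<omega>)) \<partial>M)"
    by (rule nn_integral_reward[OF t W]) measurable
  also have "\<dots> \<le> (\<integral>\<^sup>+\<omega>. ?A \<omega> * ?V \<omega> \<partial>M)"
    by (rule nn_integral_mono) (rule kernel)
  also have "(\<integral>\<^sup>+\<omega>. ?B \<omega> * ?V \<omega> \<partial>M) + \<dots> = (\<integral>\<^sup>+\<omega>. ?B \<omega> * ?V \<omega> + ?A \<omega> * ?V \<omega> \<partial>M)"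
    by (rule nn_integral_add[symmetric]) measurable
  also have "\<dots> = (\<integral>\<^sup>+\<omega>. ?V \<omega> \<partial>M)"
    by (rule nn_integral_cong) (simp add: same_def)
  also have "\<dots> \<le> 1" by (rule step.IH)
  finally show ?case by (simp add: add_left_mono)
qed

text \<open>Chernoff's method. Fixing the play count to \<open>n\<close> makes the compensator
  deterministic on the event, and the sign \<open>\<sigma>\<close> selects the tail.\<close>

lemma prob_deviation_one_sided:
  assumes "1 \<le> s" "s \<le> t" and \<sigma>: "\<sigma>\<^sup>2 = (1::real)" and n: "1 \<le> n" and a: "0 \<le> a"
  shows "prob {\<omega> \<in> space M. play_count s t \<omega> = real n \<and> a \<le> \<sigma> * deviation s t \<omega>}
    \<le> exp (- 2 * a\<^sup>2 / real n)"
proof -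
  note [measurable] = play_count_measurable[OF assms(1)] deviation_measurable[OF assms(1)]
  \<comment> \<open>This \<open>l\<close> minimises
    \<open>l\<^sup>2 / 8 * n - l * a\<close>.\<close>
  define l where "l = 4 * a / real n"
  let ?u = "\<lambda>\<omega>. ennreal (exp ((\<sigma> * l) * deviation s t \<omega> - (\<sigma> * l)\<^sup>2 / 8 * play_count s t \<omega>))"
  let ?c = "ennreal (exp (- 2 * a\<^sup>2 / real n))"
  have l: "l\<^sup>2 / 8 * real n - l * a = - 2 * a\<^sup>2 / real n"
    using n by (simp add: l_def field_simps power2_eq_square)
  have "emeasure M {\<omega> \<in> space M. play_count s t \<omega> = real n \<and> a \<le> \<sigma> * deviation s t \<omega>}
      \<le> emeasure M {\<omega> \<in> space M. 1 \<le> ?c * ?u \<omega>}"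
  proof (rule emeasure_mono)
    show "{\<omega> \<in> space M. play_count s t \<omega> = real n \<and> a \<le> \<sigma> * deviation s t \<omega>}
        \<subseteq> {\<omega> \<in> space M. 1 \<le> ?c * ?u \<omega>}"
    proof safe
      fix \<omega> assume *: "play_count s t \<omega> = real n" "a \<le> \<sigma> * deviation s t \<omega>"
      have "l * a \<le> l * (\<sigma> * deviation s t \<omega>)"
        using * a by (intro mult_left_mono) (auto simp: l_def)
      then have "0 \<le> - 2 * a\<^sup>2 / real n + ((\<sigma> * l) * deviation s t \<omega> - (\<sigma> * l)\<^sup>2 / 8 * play_count s t \<omega>)"
        using * \<sigma> unfolding l[symmetric] by (simp add: power_mult_distrib mult_ac)
      then show "1 \<le> ?c * ?u \<omega>"
        by (simp flip: ennreal_mult exp_add)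
    qed
  qed measurable
  also have "\<dots> \<le> ?c * (\<integral>\<^sup>+\<omega>. ?u \<omega> * indicator (space M) \<omega> \<partial>M)"
    by (rule nn_integral_Markov_inequality) measurable
  also have "\<dots> \<le> ?c * 1"
    using exp_supermartingale[OF assms(1,2), of "\<sigma> * l"]
    by (intro mult_left_mono) (simp_all cong: nn_integral_cong_simp add: nn_integral_set_ennreal)
  finally show ?thesis by (simp add: emeasure_eq_measure)
qed

section \<open>Deviation events and their union bound\<close>

definition deviation_event :: "nat \<Rightarrow> nat \<Rightarrow> nat \<Rightarrow> nat \<Rightarrow> 'w set" where
  "deviation_event i s t n = {\<omega> \<in> space M. play_count s t \<omega> = real n \<and>
     real n * sqrt (8 * real i / (1 + real n)) \<le> \<bar>deviation s t \<omega>\<bar>}"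

lemma deviation_event_sets [measurable]: "1 \<le> s \<Longrightarrow> deviation_event i s t n \<in> sets M"
  unfolding deviation_event_def by measurable

text \<open>For \<open>n \<ge> 1\<close> the exponent
  \<open>2 * a\<^sup>2 / n = 16 * i * n / (1 + n)\<close> is at least \<open>8 * i\<close>, and
  \<open>exp (- 8) \<le> 1 / 256\<close> since \<open>2 \<le> exp 1\<close>.\<close>

lemma prob_deviation_event:
  assumes "1 \<le> s" "s \<le> t" "1 \<le> n"
  shows "prob (deviation_event i s t n) \<le> 2 * (1 / 256) ^ i"
proof -
  note [measurable] = play_count_measurable[OF assms(1)] deviation_measurable[OF assms(1)]
  define a where "a = real n * sqrt (8 * real i / (1 + real n))"
  let ?E = "\<lambda>\<sigma>. {\<omega> \<in> space M. play_count s t \<omega> = real n \<and> a \<le> \<sigma> * deviation s t \<omega>}"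
  have "8 * real i \<le> 2 * a\<^sup>2 / real n"
  proof -
    have "2 * a\<^sup>2 / real n = 16 * real i * real n / (1 + real n)"
      using assms(3) unfolding a_def power_mult_distrib by (simp add: power2_eq_square[of "real n"])
    moreover have "8 * real i * (1 + real n) \<le> 8 * real i * (2 * real n)"
      using assms(3) by (intro mult_left_mono) auto
    ultimately show ?thesis by (simp add: le_divide_eq)
  qed
  then have "exp (- 2 * a\<^sup>2 / real n) \<le> exp (- (8 * real i))" by simp
  also have "\<dots> = exp (- 8) ^ i"
    by (simp add: mult.commute flip: exp_of_nat_mult)
  also have "\<dots> \<le> (1 / 256) ^ i"
  proof (rule power_mono)
    have "(2::real) ^ 8 \<le> exp 1 ^ 8"
      using exp_ge_add_one_self[of 1] by (intro power_mono) auto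
    also have "\<dots> = exp 8"
      using exp_of_nat_mult[of 8 "1::real"] by simp
    finally show "exp (- 8) \<le> (1 / 256 :: real)"
      by (simp add: exp_minus inverse_eq_divide divide_simps)
  qed simp
  finally have exp_le: "exp (- 2 * a\<^sup>2 / real n) \<le> (1 / 256) ^ i" .
  have "prob (deviation_event i s t n) \<le> prob (?E 1 \<union> ?E (-1))"
    by (intro finite_measure_mono) (auto simp: deviation_event_def a_def)
  also have "\<dots> \<le> prob (?E 1) + prob (?E (-1))"
    by (intro measure_Un_le) measurable
  also have "\<dots> \<le> (1 / 256) ^ i + (1 / 256) ^ i"
    by (intro add_mono order_trans[OF prob_deviation_one_sided exp_le] assms) (simp_all add: a_def)
  finally show ?thesis by simp
qed

text \<open>Rounds \<open>s\<close> stand in for arms: \<open>X\<close> may be infinite, but a phase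
  has at most \<open>2 ^ i\<close> rounds, which leaves at most \<open>8 ^ i\<close>
  triples.\<close>

definition bad_indices :: "nat \<Rightarrow> (nat \<times> nat \<times> nat) set" where
  "bad_indices i = {(s, t, n). phase s = i \<and> phase t = i \<and> s \<le> t \<and> n \<in> {1..2 ^ i}}"

definition bad_phase :: "nat \<Rightarrow> 'w set" where
  "bad_phase i = (\<Union>(s, t, n)\<in>bad_indices i. deviation_event i s t n)"

lemma finite_bad_indices: "finite (bad_indices i)"
  and card_bad_indices_le: "card (bad_indices i) \<le> 8 ^ i"
proof -
  let ?S = "{s. phase s = i}"
  have sub: "bad_indices i \<subseteq> ?S \<times> ?S \<times> {1..2 ^ i}"
    by (auto simp: bad_indices_def)
  show "finite (bad_indices i)"
    by (rule finite_subset[OF sub]) simp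
  have "card (bad_indices i) \<le> card (?S \<times> ?S \<times> {1..(2::nat) ^ i})"
    by (rule card_mono[OF _ sub]) simp
  also have "\<dots> \<le> 2 ^ i * (2 ^ i * 2 ^ i)"
    unfolding card_cartesian_product by (intro mult_mono card_phase_le) auto
  also have "\<dots> = 8 ^ i" by (simp flip: power_mult_distrib)
  finally show "card (bad_indices i) \<le> 8 ^ i" .
qed

lemma bad_indices_pos:
  assumes "1 \<le> i" "(s, t, n) \<in> bad_indices i"
  shows "1 \<le> s" "s \<le> t" "1 \<le> n"
  using assms phase_pos_imp[of s] by (auto simp: bad_indices_def)

lemma bad_phase_sets:
  assumes "1 \<le> i" shows "bad_phase i \<in> sets M"
  unfolding bad_phase_def using bad_indices_pos[OF assms]
  by (intro sets.finite_UN finite_bad_indices) (auto intro!: deviation_event_sets)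

text \<open>The union bound gives \<open>2 * (8 / 256) ^ i\<close>, small enough to absorb the
  factor \<open>2 ^ i\<close>. That factor bounds the number of rounds, so a failed phase has
  constant expected weight.\<close>

lemma prob_bad_phase:
  assumes i: "1 \<le> i"
  shows "2 ^ i * prob (bad_phase i) \<le> 1"
proof -
  have "prob (bad_phase i) \<le> (\<Sum>p\<in>bad_indices i. prob (case p of (s, t, n) \<Rightarrow> deviation_event i s t n))"
    unfolding bad_phase_def using bad_indices_pos[OF i]
    by (intro finite_measure_subadditive_finite finite_bad_indices) (auto intro!: deviation_event_sets)
  also have "\<dots> \<le> (\<Sum>_\<in>bad_indices i. 2 * (1 / 256) ^ i)"
  proof (rule sum_mono)
    fix p assume "p \<in> bad_indices i"
    then show "prob (case p of (s, t, n) \<Rightarrow> deviation_event i s t n) \<le> 2 * (1 / 256) ^ i"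
      using bad_indices_pos[OF i] prob_deviation_event by (cases p) simp
  qed
  also have "\<dots> = real (card (bad_indices i)) * (2 * (1 / 256) ^ i)" by simp
  also have "\<dots> \<le> 8 ^ i * (2 * (1 / 256) ^ i)"
  proof (rule mult_right_mono)
    show "real (card (bad_indices i)) \<le> 8 ^ i"
      using card_bad_indices_le[of i] by (metis of_nat_le_iff of_nat_numeral of_nat_power)
  qed simp
  finally have "2 ^ i * prob (bad_phase i) \<le> 2 ^ i * (8 ^ i * (2 * (1 / 256) ^ i))"
    by (intro mult_left_mono) auto
  also have "\<dots> = 2 * (1 / 16) ^ i"
    by (simp add: mult_ac flip: power_mult_distrib)
  also have "\<dots> \<le> 2 * (1 / 16) ^ 1"
    using i by (intro mult_left_mono power_decreasing) auto
  finally show ?thesis by simp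
qed

lemma confident_if_not_bad:
  assumes i: "1 \<le> i" and \<omega>: "\<omega> \<in> space M" "\<omega> \<notin> bad_phase i"
  shows "confident X \<mu> (\<lambda>t. x t \<omega>) (\<lambda>t. y t \<omega>) i"
  unfolding confident_def
proof safe
  fix t a assume t: "i = phase t" and a: "a \<in> X"
  let ?x = "\<lambda>t. x t \<omega>" and ?y = "\<lambda>t. y t \<omega>"
  define Q where "Q = plays_before ?x t a"
  define n where "n = num_plays ?x t a"
  have finQ: "finite Q" by (simp add: Q_def plays_before_def)
  have n: "n = card Q" by (simp add: n_def num_plays_def Q_def)
  show "\<bar>avg_reward ?x ?y t a - \<mu> a\<bar> \<le> conf_radius ?x t a"
  proof (cases "n = 0")
    case True
    \<comment> \<open>An unplayed arm has average \<open>0\<close> and mean in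
      \<open>{0..1}\<close>, so a radius of at least \<open>1\<close> suffices.\<close>
    then have "1 \<le> conf_radius ?x t a"
      using i t by (simp add: conf_radius_def n_def)
    then show ?thesis using True mean_range[OF a] by (simp add: avg_reward_def n_def)
  next
    case False
    then have "Q \<noteq> {}" by (auto simp: n)
    \<comment> \<open>The first play in the phase represents the arm \<open>a\<close>, so that
      \<open>play_count\<close> and \<open>deviation\<close> from \<open>s\<close> on capture all
      its plays.\<close>
    define s where "s = Min Q"
    have "s \<in> Q" unfolding s_def by (rule Min_in[OF finQ \<open>Q \<noteq> {}\<close>])
    then have s: "s < t" "phase s = i" "x s \<omega> = a" by (auto simp: Q_def plays_before_def t)
    have "1 \<le> s" using phase_pos_imp s i by simp
    have Q_eq: "Q = {u \<in> {s..<t}. x u \<omega> = x s \<omega>}"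
    proof (intro set_eqI iffI)
      fix u assume "u \<in> Q"
      then show "u \<in> {u \<in> {s..<t}. x u \<omega> = x s \<omega>}"
        using Min_le[OF finQ, of u] s by (auto simp: s_def Q_def plays_before_def)
    next
      fix u assume u: "u \<in> {u \<in> {s..<t}. x u \<omega> = x s \<omega>}"
      \<comment> \<open>\<open>play_count\<close> does not mention phases, but by monotonicity all
        rounds between \<open>s\<close> and \<open>t\<close> lie in phase \<open>i\<close>.\<close>
      then have "phase s \<le> phase u" "phase u \<le> phase t" by (auto intro!: phase_mono)
      then show "u \<in> Q" using u s t by (auto simp: Q_def plays_before_def)
    qed
    have count: "play_count s t \<omega> = real n"
      unfolding play_count_def same_def n Q_eq by (simp add: of_bool_def sum.If_cases Int_def)
    have "deviation s t \<omega> = (\<Sum>u\<in>Q. y u \<omega> - \<mu> (x u \<omega>))"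
      unfolding deviation_def same_def Q_eq by (rule sum.mono_neutral_cong_right) auto
    also have "\<dots> = (\<Sum>u\<in>Q. y u \<omega>) - real n * \<mu> a"
      using s(3) by (simp add: Q_eq n sum_subtractf)
    also have "\<dots> = real n * (avg_reward ?x ?y t a - \<mu> a)"
      using False by (simp add: avg_reward_def n_def[symmetric] Q_def field_simps)
    finally have dev: "deviation s t \<omega> = real n * (avg_reward ?x ?y t a - \<mu> a)" .
    have "card Q \<le> card {s. phase s = i}"
      by (intro card_mono) (auto simp: Q_def plays_before_def t)
    then have "n \<in> {1..2 ^ i}"
      using card_phase_le[of i] False n by auto
    then have "\<omega> \<notin> deviation_event i s t n"
      using \<omega>(2) s t by (auto simp: bad_phase_def bad_indices_def)
    then have "real n * \<bar>avg_reward ?x ?y t a - \<mu> a\<bar> \<le> real n * sqrt (8 * real i / (1 + real n))"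
      using \<omega>(1) count by (auto simp: deviation_event_def dev abs_mult)
    then show ?thesis
      using False by (simp add: conf_radius_def n_def t)
  qed
qed

end

section \<open>Regret\<close>

locale zooming_process = bandit_instance X D \<mu> P M F x y
  for X :: "'a set" and D \<mu> P and M :: "'w measure" and F x y +
  fixes z :: "nat \<Rightarrow> 'w \<Rightarrow> 'a option"
  assumes zooming: "\<omega> \<in> space M \<Longrightarrow> zooming_run X D (\<lambda>t. z t \<omega>) (\<lambda>t. x t \<omega>) (\<lambda>t. y t \<omega>)"
begin

lemma regret_eq: "regret X \<mu> M x t = (\<integral>\<omega>. (\<Sum>s=1..t. gap X \<mu> (x s \<omega>)) \<partial>M)"
proof -
  have "integrable M (\<lambda>\<omega>. \<mu> (x s \<omega>))" if "s \<in> {1..t}" for s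
    using that mean_range[OF arm_in] by (intro integrable_const_bound[where B=1]) (auto intro!: AE_I2)
  then have "integrable M (\<lambda>\<omega>. \<Sum>s=1..t. \<mu> (x s \<omega>))" by (intro Bochner_Integration.integrable_sum)
  then show ?thesis by (simp add: regret_def gap_def sum_subtractf prob_space)
qed

text \<open>A confident phase costs at most \<open>144 * i * K\<close> beyond \<open>\<rho>\<close>
  per round. A bad one has at most \<open>2 ^ i\<close> rounds of cost \<open>\<rho> + K\<close>,
  which adds at most \<open>K\<close> in expectation by \<open>prob_bad_phase\<close>.\<close>

lemma regret_le:
  assumes \<rho>: "0 < \<rho>"
    and R: "finite R" "\<And>r. r \<in> R \<longleftrightarrow> r \<in> dyadic_scales \<and> \<rho> \<le> r"
    and C: "\<And>r. r \<in> R \<Longrightarrow> finite (\<C> r)"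
      "\<And>r S. r \<in> R \<Longrightarrow> S \<in> \<C> r \<Longrightarrow> set_diam D S < ennreal (r / 8)"
      "\<And>r. r \<in> R \<Longrightarrow> gap_layer X \<mu> r \<subseteq> \<Union>(\<C> r)"
  shows "regret X \<mu> M x t \<le>
    \<rho> * real t + 580 * (ln (1 + real t))\<^sup>2 * (\<Sum>r\<in>R. real (card (\<C> r)) / r)"
proof -
  let ?g = "gap X \<mu>"
  define K where "K = (\<Sum>r\<in>R. real (card (\<C> r)) / r)"
  define n where "n = phase t"
  define J where "J i = {s. s < Suc t \<and> phase s = i}" for i
  have R_range: "0 < r" "r \<le> 1" if "r \<in> R" for r
    using R(2)[of r] that \<rho> by (auto simp: dyadic_scales_def)
  have K0: "0 \<le> K"
    unfolding K_def using R_range by (intro sum_nonneg) (auto simp: less_imp_le)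
  \<comment> \<open>Lets the failure of a phase be charged to \<open>K\<close>, which may vanish.\<close>
  have gap_le: "?g a \<le> \<rho> + K" if a: "a \<in> X" for a
  proof (cases "?g a \<le> \<rho>")
    case False
    then have "0 < ?g a" using \<rho> by linarith
    then obtain r where r: "r \<in> dyadic_scales" "a \<in> gap_layer X \<mu> r"
      using gap_in_layer[OF a] by blast
    then have rR: "r \<in> R" using False R(2) by (auto simp: gap_layer_def)
    have "\<C> r \<noteq> {}" using C(3)[OF rR] r(2) by auto
    then have "1 \<le> real (card (\<C> r))"
      using C(1)[OF rR] by (simp add: Suc_leI card_gt_0_iff)
    then have "1 \<le> real (card (\<C> r)) / r"
      using R_range[OF rR] by (simp add: le_divide_eq)
    also have "\<dots> \<le> K"
      unfolding K_def using rR R(1) R_range by (intro member_le_sum) (auto simp: less_imp_le)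
    finally show ?thesis using gap_le_1[OF a] \<rho> by linarith
  qed (use K0 in simp)
  have phase_sum: "(\<Sum>s\<in>J i. ?g (x s \<omega>)) \<le>
      \<rho> * real (card (J i)) + K * (144 * real i + 2 ^ i * indicator (bad_phase i) \<omega>)"
    if \<omega>: "\<omega> \<in> space M" and i: "1 \<le> i" for \<omega> i
  proof (cases "\<omega> \<in> bad_phase i")
    case False
    interpret zooming_trajectory X D \<mu> P "\<lambda>t. z t \<omega>" "\<lambda>t. x t \<omega>" "\<lambda>t. y t \<omega>"
      using zooming[OF \<omega>] by unfold_locales
    show ?thesis
      using phase_regret_confident[OF confident_if_not_bad[OF i \<omega> False] i \<rho> R C, of "Suc t"] False
      by (simp add: J_def K_def mult_ac)
  next
    case True
    have "(\<Sum>s\<in>J i. ?g (x s \<omega>)) \<le> (\<Sum>s\<in>J i. \<rho> + K)"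
      using i phase_pos_imp by (intro sum_mono gap_le arm_in[OF _ \<omega>]) (auto simp: J_def)
    also have "\<dots> = \<rho> * real (card (J i)) + K * real (card (J i))"
      by (simp add: algebra_simps)
    also have "\<dots> \<le> \<rho> * real (card (J i)) + K * (144 * real i + 2 ^ i)"
    proof (intro add_left_mono mult_left_mono[OF _ K0])
      have "card (J i) \<le> card {s. phase s = i}" by (intro card_mono) (auto simp: J_def)
      also have "\<dots> \<le> 2 ^ i" by (rule card_phase_le)
      finally have "real (card (J i)) \<le> 2 ^ i" by (metis of_nat_le_iff of_nat_numeral of_nat_power)
      then show "real (card (J i)) \<le> 144 * real i + 2 ^ i" by linarith
    qed
    finally show ?thesis using True by simp
  qed
  have group: "sum h {1..t} = (\<Sum>i=1..n. sum h (J i))" for h :: "nat \<Rightarrow> real"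
  proof -
    have "sum h {1..t} = (\<Sum>i=1..n. sum h {s\<in>{1..t}. phase s = i})"
      using phase_pos phase_mono by (intro sum.group[symmetric]) (auto simp: n_def)
    also have "\<dots> = (\<Sum>i=1..n. sum h (J i))"
      using phase_pos_imp by (intro sum.cong) (auto simp: J_def)
    finally show ?thesis .
  qed
  let ?B = "\<lambda>\<omega>. \<rho> * real t + (\<Sum>i=1..n. K * (144 * real i + 2 ^ i * indicator (bad_phase i) \<omega>))"
  have path: "(\<Sum>s=1..t. ?g (x s \<omega>)) \<le> ?B \<omega>" if "\<omega> \<in> space M" for \<omega>
  proof -
    have "(\<Sum>s=1..t. ?g (x s \<omega>)) = (\<Sum>i=1..n. \<Sum>s\<in>J i. ?g (x s \<omega>))" by (rule group)
    also have "\<dots> \<le> (\<Sum>i=1..n. \<rho> * real (card (J i)) + K * (144 * real i + 2 ^ i * indicator (bad_phase i) \<omega>))"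
      by (intro sum_mono phase_sum that) simp
    also have "\<dots> = ?B \<omega>"
      using group[of "\<lambda>_. 1"] by (simp add: sum.distrib flip: sum_distrib_left)
    finally show ?thesis .
  qed
  have ind: "integrable M (indicat_real (bad_phase i))" if "i \<in> {1..n}" for i
    using bad_phase_sets[of i] that by (intro integrable_real_indicator) (auto simp: less_top[symmetric])
  have intB: "integrable M ?B"
    using ind by (intro Bochner_Integration.integrable_add Bochner_Integration.integrable_sum
        integrable_mult_right integrable_const) auto
  have "regret X \<mu> M x t \<le> (\<integral>\<omega>. ?B \<omega> \<partial>M)"
    unfolding regret_eq
  proof (rule integral_mono[OF _ intB path])
    show "integrable M (\<lambda>\<omega>. \<Sum>s=1..t. ?g (x s \<omega>))"
      unfolding gap_def using mean_range[OF arm_in]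
      by (intro Bochner_Integration.integrable_sum Bochner_Integration.integrable_diff integrable_const
          integrable_const_bound[where B=1]) (auto intro!: AE_I2)
  qed
  also have "\<dots> = \<rho> * real t + (\<Sum>i=1..n. K * (144 * real i + 2 ^ i * prob (bad_phase i)))"
  proof -
    let ?f = "\<lambda>i \<omega>. K * (144 * real i + 2 ^ i * indicator (bad_phase i) \<omega>)"
    have f: "integrable M (?f i)" "(\<integral>\<omega>. ?f i \<omega> \<partial>M) = K * (144 * real i + 2 ^ i * prob (bad_phase i))"
      if "i \<in> {1..n}" for i
      using ind[OF that] bad_phase_sets[of i] that by (simp_all add: prob_space)
    have "(\<integral>\<omega>. ?B \<omega> \<partial>M) = \<rho> * real t + (\<integral>\<omega>. (\<Sum>i=1..n. ?f i \<omega>) \<partial>M)"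
      using f(1) by (subst Bochner_Integration.integral_add)
        (auto simp: prob_space intro!: Bochner_Integration.integrable_sum)
    also have "(\<integral>\<omega>. (\<Sum>i=1..n. ?f i \<omega>) \<partial>M) = (\<Sum>i=1..n. \<integral>\<omega>. ?f i \<omega> \<partial>M)"
      by (rule Bochner_Integration.integral_sum) (rule f(1))
    also have "\<dots> = (\<Sum>i=1..n. K * (144 * real i + 2 ^ i * prob (bad_phase i)))"
      by (rule sum.cong[OF refl f(2)])
    finally show ?thesis .
  qed
  \<comment> \<open>Each phase contributes \<open>144 * i + 1\<close>, at most
    \<open>145 * n\<close> as \<open>1 \<le> i \<le> n\<close>. Summing over \<open>n\<close> phases
    produces the squared logarithm.\<close>
  also have "\<dots> \<le> \<rho> * real t + (\<Sum>i=1..n. K * (145 * real n))"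
  proof (intro add_left_mono sum_mono mult_left_mono[OF _ K0])
    fix i assume "i \<in> {1..n}"
    then show "144 * real i + 2 ^ i * prob (bad_phase i) \<le> 145 * real n"
      using prob_bad_phase[of i] by simp
  qed
  also have "\<dots> = \<rho> * real t + 145 * (real n)\<^sup>2 * K"
    by (simp add: power2_eq_square)
  \<comment> \<open>The factor \<open>2\<close> of \<open>phase_le_log\<close>, squared, turns
    \<open>145\<close> into \<open>580\<close>.\<close>
  also have "\<dots> \<le> \<rho> * real t + 145 * (2 * ln (1 + real t))\<^sup>2 * K"
    using phase_le_log[of t] K0 unfolding n_def
    by (intro add_left_mono mult_right_mono mult_left_mono power_mono) auto
  finally show ?thesis by (simp add: K_def power_mult_distrib)
qed

end

section \<open>Finitely many scales, optimal covers and the final bound\<close>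

lemma finite_dyadic_scales_ge:
  assumes "0 < \<rho>" shows "finite {r \<in> dyadic_scales. \<rho> \<le> r}"
proof -
  obtain k where k: "(1 / 2) ^ k < \<rho>"
    using real_arch_pow_inv[OF assms, of "1 / 2"] by auto
  have "{r \<in> dyadic_scales. \<rho> \<le> r} \<subseteq> (\<lambda>i. 1 / 2 ^ i) ` {..<k}"
  proof safe
    fix r assume "r \<in> dyadic_scales" "\<rho> \<le> r"
    then obtain i where i: "r = (1 / 2) ^ i" by (auto simp: dyadic_scales_def power_one_over)
    have "i < k"
    proof (rule ccontr)
      assume "\<not> i < k"
      then have "(1 / 2 :: real) ^ i \<le> (1 / 2) ^ k" by (intro power_decreasing) auto
      with k \<open>\<rho> \<le> r\<close> i show False by simp
    qed
    then show "r \<in> (\<lambda>i. 1 / 2 ^ i) ` {..<k}" using i by (auto simp: power_one_over)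
  qed
  then show ?thesis by (rule finite_subset) simp
qed

text \<open>A finite infimum in \<open>enat\<close> comes from a nonempty set, and well-ordering
  makes it a minimum.\<close>

lemma covering_number_attained:
  assumes "covering_number X D r Y \<noteq> \<infinity>"
  obtains \<C> where "finite \<C>" "\<And>S. S \<in> \<C> \<Longrightarrow> set_diam D S < ennreal r" "Y \<subseteq> \<Union>\<C>"
    "covering_number X D r Y = enat (card \<C>)"
proof -
  let ?A = "{enat (card \<C>) | \<C>. finite \<C> \<and> (\<forall>S\<in>\<C>. S \<subseteq> X \<and> set_diam D S < ennreal r) \<and> Y \<subseteq> \<Union>\<C>}"
  have "?A \<noteq> {}" using assms unfolding covering_number_def Inf_enat_def by metis
  then have "Inf ?A \<in> ?A" unfolding Inf_enat_def by (auto intro: LeastI)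
  then show thesis using that unfolding covering_number_def by blast
qed

theorem theorem4p4:
  shows "\<exists>C::real. 0 < C \<and> C \<le> 10 ^ 6 \<and>
    (\<forall>(X :: 'a set) D \<mu> P (M :: 'w measure) F z x y.
       relaxed_lipschitz_mab X D \<mu> P \<longrightarrow>
       bandit_process M F X P x y \<longrightarrow>
       (\<forall>\<omega>\<in>space M. zooming_run X D (\<lambda>t. z t \<omega>) (\<lambda>t. x t \<omega>) (\<lambda>t. y t \<omega>)) \<longrightarrow>
       (\<forall>t::nat. ereal (regret X \<mu> M x t) \<le>
          (INF \<rho>\<in>{0::real<..}.
             ereal (\<rho> * real t) +
             ereal (C * (ln (1 + real t))\<^sup>2) *
               (\<Sum>r\<in>{r \<in> dyadic_scales. \<rho> \<le> r}.
                  ereal (1 / r) * ereal_of_enat (covering_number X D (r / 8) (gap_layer X \<mu> r))))))"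
proof (intro exI[of _ 580] conjI allI impI INF_greatest)
  fix X :: "'a set" and D \<mu> P and M :: "'w measure" and F z x y t and \<rho> :: real
  assume "relaxed_lipschitz_mab X D \<mu> P" "bandit_process M F X P x y"
    and run: "\<forall>\<omega>\<in>space M. zooming_run X D (\<lambda>t. z t \<omega>) (\<lambda>t. x t \<omega>) (\<lambda>t. y t \<omega>)"
    and \<rho>: "\<rho> \<in> {0<..}"
  then interpret relaxed_lipschitz_mab X D \<mu> P + bandit_process M F X P x y by simp_all
  interpret zooming_process X D \<mu> P M F x y z
    using run by unfold_locales blast
  define R where "R = {r \<in> dyadic_scales. \<rho> \<le> r}"
  define N where "N r = covering_number X D (r / 8) (gap_layer X \<mu> r)" for r
  have finR: "finite R" using \<rho> by (simp add: R_def finite_dyadic_scales_ge)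
  have pos: "0 < r" if "r \<in> R" for r using that \<rho> by (simp add: R_def)
  let ?L = "580 * (ln (1 + real t))\<^sup>2"
  have "ereal (regret X \<mu> M x t) \<le> ereal (\<rho> * real t) + ereal ?L * (\<Sum>r\<in>R. ereal (1 / r) * ereal_of_enat (N r))"
  proof (cases "\<forall>r\<in>R. N r \<noteq> \<infinity>")
    case True
    then have "\<forall>r\<in>R. \<exists>\<C>. finite \<C> \<and> (\<forall>S\<in>\<C>. set_diam D S < ennreal (r / 8)) \<and>
        gap_layer X \<mu> r \<subseteq> \<Union>\<C> \<and> N r = enat (card \<C>)"
      unfolding N_def by (meson covering_number_attained)
    then obtain \<C> where C: "\<And>r. r \<in> R \<Longrightarrow> finite (\<C> r)"
      "\<And>r S. r \<in> R \<Longrightarrow> S \<in> \<C> r \<Longrightarrow> set_diam D S < ennreal (r / 8)"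
      "\<And>r. r \<in> R \<Longrightarrow> gap_layer X \<mu> r \<subseteq> \<Union>(\<C> r)"
      "\<And>r. r \<in> R \<Longrightarrow> N r = enat (card (\<C> r))"
      by metis
    have "(\<Sum>r\<in>R. ereal (1 / r) * ereal_of_enat (N r)) = ereal (\<Sum>r\<in>R. real (card (\<C> r)) / r)"
      by (simp add: C(4) flip: sum_ereal)
    moreover have "regret X \<mu> M x t \<le> \<rho> * real t + ?L * (\<Sum>r\<in>R. real (card (\<C> r)) / r)"
      using \<rho> by (intro regret_le finR C) (auto simp: R_def)
    ultimately show ?thesis by simp
  next
    case False
    then obtain r where r: "r \<in> R" "N r = \<infinity>" by blast
    have "(\<Sum>r\<in>R. ereal (1 / r) * ereal_of_enat (N r)) = \<infinity>"
      using r pos[OF r(1)] finR by (auto simp: sum_Pinfty intro!: bexI[of _ r])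
    \<comment> \<open>For \<open>t > 0\<close> the right-hand side is infinite. For
      \<open>t = 0\<close> the logarithm vanishes, \<open>0 * \<infinity> = 0\<close> in
      \<open>ereal\<close>, and the regret is \<open>0\<close> as well.\<close>
    then show ?thesis
      by (cases "t = 0") (simp_all add: regret_def)
  qed
  then show "ereal (regret X \<mu> M x t) \<le> ereal (\<rho> * real t) + ereal ?L *
      (\<Sum>r\<in>{r \<in> dyadic_scales. \<rho> \<le> r}.
         ereal (1 / r) * ereal_of_enat (covering_number X D (r / 8) (gap_layer X \<mu> r)))"
    by (simp add: R_def N_def)
qed simp_all

end
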